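(* Let $f\in\mathcal{F}'$ be of infinite $*$-order and such that $\{\mu_n\,\mu_{n+2}\,\mu_{n+1}^{-2}: n\ge1\}$ is a bounded sequence. Then the following statements are equivalent: (i* ) $f^{n*}\to1$ in probability as $n\to\infty$, i.e. for every $\varepsilon>0$ the Lebesgue measure of $\{x\in(0,1): |f^{n*}(x)-1|>\varepsilon\}$ tends to $0$ as $n\to\infty$; (ii) for all $r>0$, $\int_0^1|f^{n*}(x)-1|^r\,dx\to0$ as $n\to\infty$ (i.e. $f^{n*}\to1$ in $L_r$); (iii) $\mu_n\,\mu_{n+2}\,\mu_{n+1}^{-2}\to1$ as $n\to\infty$.
   Context: $\mathcal{F}'$ is the class of cumulative distribution functions $F$ on $\mathbb{R}$ that are absolutely continuous with respect to Lebesgue measure and whose density $f=F'$ is positive (almost everywhere on the support of $F$, and zero outside the support). We write $f\in\mathcal{F}'$ for the density of such an $F$. For such $F$, the quantile function is $Q(u)=\inf\{x: F(x)\ge u\}$, $0<u<1$. If $\kappa_0=\int_{-\infty}^{\infty} f(x)^2\,dx<\infty$, the probability density quantile (pdQ) of $f$ is the probability density on $(0,1)$ given by $f^*(u)=f(Q(u))/\kappa_0$, $0<u<1$; if $\kappa_0=\infty$, $f^*$ does not exist. Iterates: $f^{1*}=f^*$ and $f^{(n+1)*}=(f^{n*})^*$ for $n\ge1$. That is, with $\kappa_n=\int_0^1 \{f^{n*}(x)\}^2\,dx$ and $Q^{n*}$ the quantile function of the distribution with density $f^{n*}$, $f^{(n+1)*}(u)=f^{n*}(Q^{n*}(u))/\kappa_n$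 for $0<u<1$; it exists if and only if $f^{n*}$ exists and $\kappa_n<\infty$. $f$ is of infinite $*$-order if $f^{n*}$ exists for every $n\ge1$. For $n\ge1$, $\mu_n=\int_{-\infty}^{\infty}\{f(y)\}^n\,dy$, the integrand being $0$ outside the support. *)

theory Defs
  imports "HOL-Probability.Probability"
begin

abbreviation law :: "(real \<Rightarrow> real) \<Rightarrow> real measure" where
  "law f \<equiv> density lborel (\<lambda>x. ennreal (f x))"

definition support :: "real measure \<Rightarrow> real set" where
  "support M = {x. \<forall>\<epsilon>>0. measure M {x - \<epsilon><..<x + \<epsilon>} > 0}"

(* The distribution function F is "cdf (law f)", absolutely continuous by construction.  Any Borel
   version f of its derivative is allowed, so F' = f is only required almost everywhere. *)
definition density_class :: "(real \<Rightarrow> real) set" where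
  "density_class = {f. f \<in> borel_measurable borel \<and> (\<forall>x. 0 \<le> f x) \<and> prob_space (law f)
     \<and> (AE x in lborel. x \<in> support (law f) \<longrightarrow> 0 < f x)
     \<and> (\<forall>x. x \<notin> support (law f) \<longrightarrow> f x = 0)}"

(* Only meaningful for 0 < u < 1, where the set is nonempty and bounded below. *)
definition quantile :: "(real \<Rightarrow> real) \<Rightarrow> real \<Rightarrow> real" where
  "quantile f u = Inf {x. u \<le> cdf (law f) x}"

definition kappa :: "(real \<Rightarrow> real) \<Rightarrow> ennreal" where
  "kappa f = (\<integral>\<^sup>+ x. ennreal ((f x)\<^sup>2) \<partial>lborel)"

(* The probability density quantile (pdQ) of f, extended by 0 outside (0,1), so that it
   is again a density on the real line and kappa integrates it over (0,1) only.
   If kappa f is infinite, this is a junk value; existence is tracked separately by pdq_exists. *)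
definition pdq :: "(real \<Rightarrow> real) \<Rightarrow> real \<Rightarrow> real" where
  "pdq f u = (if 0 < u \<and> u < 1 then f (quantile f u) / enn2real (kappa f) else 0)"

primrec pdq_iter :: "(real \<Rightarrow> real) \<Rightarrow> nat \<Rightarrow> real \<Rightarrow> real" where
  "pdq_iter f 0 = f"
| "pdq_iter f (Suc n) = pdq (pdq_iter f n)"

primrec pdq_exists :: "(real \<Rightarrow> real) \<Rightarrow> nat \<Rightarrow> bool" where
  "pdq_exists f 0 \<longleftrightarrow> True"
| "pdq_exists f (Suc n) \<longleftrightarrow> pdq_exists f n \<and> kappa (pdq_iter f n) < \<infinity>"

definition infinite_star_order :: "(real \<Rightarrow> real) \<Rightarrow> bool" where
  "infinite_star_order f \<longleftrightarrow> (\<forall>n\<ge>1. pdq_exists f n)"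

(* For f in density_class of infinite star order, every power f^n with n >= 1 is integrable,
   so the Bochner integral is the true moment there. *)
definition mu :: "(real \<Rightarrow> real) \<Rightarrow> nat \<Rightarrow> real" where
  "mu f n = (\<integral>y. (f y) ^ n \<partial>lborel)"

end

(* Q(U) has density h when U is uniform on (0,1) and Q is the quantile function of h.  Iterating,
   for n >= 1 the law of f^{n*}(U) is the law of f/c under the density f^n / mu_n, where
   c = mu_{n+1} / mu_n because f^{n*}(U) has mean 1.  Hence f^{n*}(U) has second moment
   mu_n mu_{n+2} / mu_{n+1}^2, so (iii) says that its variance tends to 0, i.e. L_2 convergence.
   Boundedness of these second moments means that mu_{n+1} / mu_n grows at most geometrically with a
   fixed ratio, which bounds all moments of f^{n*}(U) uniformly in n and thus upgrades convergence
   in probability to convergence in every L_r. *)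

theory Submission
  imports Defs
begin

section \<open>Probability densities and the quantile transform\<close>

text \<open>Keeps those properties that pass from a density to its pdQ when \<open>kappa\<close> is
  finite, so that they reach every iterate by induction.\<close>

definition prob_density :: "(real \<Rightarrow> real) \<Rightarrow> bool" where
  "prob_density h \<longleftrightarrow> h \<in> borel_measurable borel \<and> (\<forall>x. 0 \<le> h x) \<and> prob_space (law h)"

lemma nn_integral_prob_density:
  assumes "prob_density h"
  shows "(\<integral>\<^sup>+ x. ennreal (h x) \<partial>lborel) = 1"
proof -
  have [measurable]: "h \<in> borel_measurable borel"
    using assms by (simp add: prob_density_def)
  interpret prob_space "law h"
    using assms by (simp add: prob_density_def)
  show ?thesis
    using emeasure_space_1 by (simp add: emeasure_density)
qed

lemma cdf_distribution_law:
  assumes "prob_density h"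
  shows "cdf_distribution (law h)"
  using assms
  by (simp add: prob_density_def cdf_distribution_def real_distribution_def
      real_distribution_axioms_def)

lemma measurable_quantile:
  assumes "prob_density h"
  shows "quantile h \<in> borel_measurable (restrict_space borel {0<..<1})"
proof -
  interpret cdf_distribution "law h"
    by (rule cdf_distribution_law[OF assms])
  show ?thesis
    \<comment> \<open>Unfolded, \<open>quantile h\<close> is the pseudo-inverse of the distribution
      function studied in the locale \<open>cdf_distribution\<close>.\<close>
    using measurable_CI by (simp add: quantile_def[abs_def])
qed

text \<open>Inverse transform sampling: the image of the uniform law on (0,1) under
  \<open>quantile h\<close> is \<open>law h\<close>. The rest is change of variables.\<close>

lemma nn_integral_quantile:
  assumes "prob_density h" and [measurable]: "G \<in> borel_measurable borel"
  shows "(\<integral>\<^sup>+ u\<in>{0<..<1}. G (quantile h u) \<partial>lborel) = (\<integral>\<^sup>+ x. ennreal (h x) * G x \<partial>lborel)"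
proof -
  have [measurable]: "h \<in> borel_measurable borel"
    using assms by (simp add: prob_density_def)
  interpret cdf_distribution "law h"
    by (rule cdf_distribution_law[OF assms(1)])
  have q: "quantile h \<in> restrict_space lborel {0<..<1} \<rightarrow>\<^sub>M borel"
    using measurable_quantile[OF assms(1)]
    by (simp cong: measurable_cong_sets sets_restrict_space_cong)
  have "(\<integral>\<^sup>+ u\<in>{0<..<1}. G (quantile h u) \<partial>lborel)
      = (\<integral>\<^sup>+ u. G (quantile h u) \<partial>restrict_space lborel {0<..<1})"
    by (subst nn_integral_restrict_space) simp_all
  also have "\<dots> = (\<integral>\<^sup>+ x. G x \<partial>distr (restrict_space lborel {0<..<1}) borel (quantile h))"
    using q by (subst nn_integral_distr) simp_all
  also have "distr (restrict_space lborel {0<..<1}) borel (quantile h) = law h"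
    using distr_I_eq_M by (simp add: quantile_def[abs_def])
  also have "(\<integral>\<^sup>+ x. G x \<partial>law h) = (\<integral>\<^sup>+ x. ennreal (h x) * G x \<partial>lborel)"
    by (subst nn_integral_density) simp_all
  finally show ?thesis .
qed

section \<open>One pdQ step\<close>

text \<open>If the square had integral 0, then h would vanish almost everywhere, against total mass
  1.\<close>

lemma kappa_pos:
  assumes "prob_density h"
  shows "0 < kappa h"
proof (rule ccontr)
  have [measurable]: "h \<in> borel_measurable borel"
    using assms by (simp add: prob_density_def)
  assume "\<not> 0 < kappa h"
  then have "(\<integral>\<^sup>+ x. ennreal ((h x)\<^sup>2) \<partial>lborel) = 0"
    by (simp add: kappa_def)
  then have "AE x in lborel. ennreal ((h x)\<^sup>2) = 0"
    by (subst (asm) nn_integral_0_iff_AE) simp_all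
  then have "AE x in lborel. ennreal (h x) = 0"
    by eventually_elim (simp add: ennreal_eq_0_iff)
  then have "(\<integral>\<^sup>+ x. ennreal (h x) \<partial>lborel) = 0"
    by (subst nn_integral_0_iff_AE) simp_all
  with nn_integral_prob_density[OF assms] show False
    by simp
qed

text \<open>\<open>enn2real\<close> sends infinity to 0, so finiteness of \<open>kappa h\<close> is
  what makes the divisor in \<open>pdq\<close> genuine.\<close>

lemma enn2real_kappa_pos:
  assumes "prob_density h" "kappa h < \<infinity>"
  shows "0 < enn2real (kappa h)"
  using kappa_pos[OF assms(1)] assms(2) by (simp add: enn2real_positive_iff)

lemma measurable_pdq:
  assumes "prob_density h"
  shows "pdq h \<in> borel_measurable borel"
proof -
  have [measurable]: "h \<in> borel_measurable borel"
    using assms by (simp add: prob_density_def)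
  have [measurable]: "quantile h \<in> borel_measurable (restrict_space borel {0<..<1})"
    by (rule measurable_quantile[OF assms])
  have "(\<lambda>u. h (quantile h u) / enn2real (kappa h)) \<in> borel_measurable (restrict_space borel {0<..<1})"
    by measurable
  \<comment> \<open>The quantile function is known to be measurable on (0,1) only; multiplying by
    the indicator extends the quotient by 0 to the line.\<close>
  then have "(\<lambda>u. indicator {0<..<1} u *\<^sub>R (h (quantile h u) / enn2real (kappa h)))
      \<in> borel_measurable borel"
    by (subst (asm) borel_measurable_restrict_space_iff) simp_all
  also have "(\<lambda>u. indicator {0<..<1} u *\<^sub>R (h (quantile h u) / enn2real (kappa h))) = pdq h"
    by (auto simp: pdq_def fun_eq_iff indicator_def)
  finally show ?thesis .
qed

lemma nn_integral_pdq:
  assumes "prob_density h" and [measurable]: "G \<in> borel_measurable borel"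
  shows "(\<integral>\<^sup>+ u\<in>{0<..<1}. G (pdq h u) \<partial>lborel)
      = (\<integral>\<^sup>+ x. ennreal (h x) * G (h x / enn2real (kappa h)) \<partial>lborel)"
proof -
  have [measurable]: "h \<in> borel_measurable borel"
    using assms by (simp add: prob_density_def)
  have "(\<integral>\<^sup>+ u\<in>{0<..<1}. G (pdq h u) \<partial>lborel)
      = (\<integral>\<^sup>+ u\<in>{0<..<1}. G (h (quantile h u) / enn2real (kappa h)) \<partial>lborel)"
    by (rule nn_integral_cong) (auto simp: pdq_def indicator_def)
  also have "\<dots> = (\<integral>\<^sup>+ x. ennreal (h x) * G (h x / enn2real (kappa h)) \<partial>lborel)"
    by (rule nn_integral_quantile[OF assms(1)]) measurable
  finally show ?thesis .
qed

text \<open>Apply \<open>nn_integral_pdq\<close> to y * G y; the weight \<open>pdq h\<close>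
  vanishes outside (0,1), so the integral may run over the whole line. Both sides now are integrals
  of a function of a density against that density, a form that can be iterated.\<close>

lemma nn_integral_pdq_weighted:
  assumes "prob_density h" and [measurable]: "G \<in> borel_measurable borel"
  shows "(\<integral>\<^sup>+ u. ennreal (pdq h u) * G (pdq h u) \<partial>lborel)
      = (\<integral>\<^sup>+ x. ennreal (h x) * (ennreal (h x / enn2real (kappa h)) * G (h x / enn2real (kappa h)))
          \<partial>lborel)"
proof -
  have "(\<integral>\<^sup>+ u. ennreal (pdq h u) * G (pdq h u) \<partial>lborel)
      = (\<integral>\<^sup>+ u\<in>{0<..<1}. ennreal (pdq h u) * G (pdq h u) \<partial>lborel)"
    by (rule nn_integral_cong) (auto simp: pdq_def indicator_def)
  also have "\<dots> = (\<integral>\<^sup>+ x. ennreal (h x) * (ennreal (h x / enn2real (kappa h))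
      * G (h x / enn2real (kappa h))) \<partial>lborel)"
    using nn_integral_pdq[OF assms(1), of "\<lambda>y. ennreal y * G y"] by simp
  finally show ?thesis .
qed

text \<open>The weighted formula with G = 1 turns the total mass of \<open>pdq h\<close> into the
  integral of h^2 / kappa, which is 1.\<close>

lemma prob_density_pdq:
  assumes "prob_density h" "kappa h < \<infinity>"
  shows "prob_density (pdq h)"
proof -
  let ?k = "enn2real (kappa h)"
  have [measurable]: "h \<in> borel_measurable borel" and h: "\<And>x. 0 \<le> h x"
    using assms by (simp_all add: prob_density_def)
  have [measurable]: "pdq h \<in> borel_measurable borel"
    by (rule measurable_pdq[OF assms(1)])
  have k: "0 < ?k"
    by (rule enn2real_kappa_pos[OF assms])
  have "(\<integral>\<^sup>+ u. ennreal (pdq h u) \<partial>lborel) = (\<integral>\<^sup>+ x. ennreal (h x) * ennreal (h x / ?k) \<partial>lborel)"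
    using nn_integral_pdq_weighted[OF assms(1), of "\<lambda>_. 1"] by simp
  also have "\<dots> = (\<integral>\<^sup>+ x. ennreal ((h x)\<^sup>2) * ennreal (1 / ?k) \<partial>lborel)"
    using h k by (intro nn_integral_cong)
      (simp add: ennreal_mult[symmetric] power2_eq_square)
  also have "\<dots> = kappa h * ennreal (1 / ?k)"
    by (simp add: nn_integral_multc kappa_def)
  also have "\<dots> = ennreal ?k * ennreal (1 / ?k)"
    using assms(2) by (simp add: less_top)
  also have "\<dots> = 1"
    using k by (subst ennreal_mult[symmetric]) simp_all
  finally have "emeasure (law (pdq h)) (space (law (pdq h))) = 1"
    by (simp add: emeasure_density)
  then have "prob_space (law (pdq h))"
    by (rule prob_spaceI)
  moreover have "0 \<le> pdq h u" for u
    using h by (simp add: pdq_def)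
  ultimately show ?thesis
    by (simp add: prob_density_def)
qed

section \<open>The law of the iterates in terms of f\<close>

lemma prob_density_pdq_iter:
  assumes "prob_density f" "pdq_exists f n"
  shows "prob_density (pdq_iter f n)"
  using assms(2) by (induction n) (auto simp: assms(1) prob_density_pdq)

text \<open>Each pdQ step contributes one more factor f to the weight and rescales the argument. The
  constants stay existential: total mass and mean determine them later.\<close>

lemma nn_integral_pdq_iter_weighted:
  assumes f: "prob_density f" and "pdq_exists f n"
  shows "\<exists>c>0. \<exists>d>0. \<forall>G\<in>borel_measurable borel.
      (\<integral>\<^sup>+ x. ennreal (pdq_iter f n x) * G (pdq_iter f n x) \<partial>lborel)
    = (\<integral>\<^sup>+ x. ennreal (f x ^ Suc n / d) * G (f x / c) \<partial>lborel)"
  using assms(2)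
proof (induction n)
  case 0
  show ?case
    by (intro exI[of _ "1::real"] conjI) simp_all
next
  case (Suc n)
  let ?h = "pdq_iter f n"
  let ?k = "enn2real (kappa ?h)"
  have f0: "0 \<le> f x" for x
    using f by (simp add: prob_density_def)
  have h: "prob_density ?h"
    using Suc.prems by (intro prob_density_pdq_iter[OF f]) simp
  have k: "0 < ?k"
    using Suc.prems by (intro enn2real_kappa_pos[OF h]) simp
  obtain c d where c: "0 < c" and d: "0 < d" and IH: "\<And>G. G \<in> borel_measurable borel \<Longrightarrow>
      (\<integral>\<^sup>+ x. ennreal (?h x) * G (?h x) \<partial>lborel)
    = (\<integral>\<^sup>+ x. ennreal (f x ^ Suc n / d) * G (f x / c) \<partial>lborel)"
    using Suc by auto
  have "(\<integral>\<^sup>+ x. ennreal (pdq_iter f (Suc n) x) * G (pdq_iter f (Suc n) x) \<partial>lborel)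
    = (\<integral>\<^sup>+ x. ennreal (f x ^ Suc (Suc n) / (d * (c * ?k))) * G (f x / (c * ?k)) \<partial>lborel)"
    if [measurable]: "G \<in> borel_measurable borel" for G
  proof -
    have weight: "ennreal (f x ^ Suc n / d) * ennreal (f x / (c * ?k))
        = ennreal (f x ^ Suc (Suc n) / (d * (c * ?k)))" for x
      using f0 c d k by (simp add: ennreal_mult[symmetric] mult_ac)
    have "(\<integral>\<^sup>+ x. ennreal (pdq_iter f (Suc n) x) * G (pdq_iter f (Suc n) x) \<partial>lborel)
        = (\<integral>\<^sup>+ x. ennreal (?h x) * (ennreal (?h x / ?k) * G (?h x / ?k)) \<partial>lborel)"
      using nn_integral_pdq_weighted[OF h that] by simp
    also have "\<dots> = (\<integral>\<^sup>+ x. ennreal (f x ^ Suc n / d)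
        * (ennreal (f x / c / ?k) * G (f x / c / ?k)) \<partial>lborel)"
      \<comment> \<open>The induction hypothesis is used for the function y / ?k * G (y /
        ?k).\<close>
      by (rule IH) measurable
    also have "\<dots> = (\<integral>\<^sup>+ x. ennreal (f x ^ Suc (Suc n) / (d * (c * ?k)))
        * G (f x / (c * ?k)) \<partial>lborel)"
      by (simp only: weight[symmetric] mult.assoc divide_divide_eq_left)
    finally show ?thesis .
  qed
  then show ?case
    using c d k
    by (intro exI[of _ "c * ?k"] exI[of _ "d * (c * ?k)"] conjI ballI mult_pos_pos)
qed

text \<open>The last pdQ step is taken without weight: under the uniform law, iterate n =
  \<open>Suc m\<close> is integrated against the density of iterate m, which already carries the
  weight f^(m+1) = f^n.\<close>

lemma nn_integral_pdq_iter:
  assumes f: "prob_density f" and "pdq_exists f n" and "1 \<le> n"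
  shows "\<exists>c>0. \<exists>d>0. \<forall>G\<in>borel_measurable borel.
      (\<integral>\<^sup>+ x\<in>{0<..<1}. G (pdq_iter f n x) \<partial>lborel)
    = (\<integral>\<^sup>+ x. ennreal (f x ^ n / d) * G (f x / c) \<partial>lborel)"
proof -
  obtain m where n: "n = Suc m"
    using assms(3) by (cases n) auto
  let ?h = "pdq_iter f m"
  let ?k = "enn2real (kappa ?h)"
  have h: "prob_density ?h"
    using assms(2) n by (intro prob_density_pdq_iter[OF f]) simp
  have k: "0 < ?k"
    using assms(2) n by (intro enn2real_kappa_pos[OF h]) simp
  obtain c d where c: "0 < c" and d: "0 < d" and *: "\<And>G. G \<in> borel_measurable borel \<Longrightarrow>
      (\<integral>\<^sup>+ x. ennreal (?h x) * G (?h x) \<partial>lborel)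
    = (\<integral>\<^sup>+ x. ennreal (f x ^ Suc m / d) * G (f x / c) \<partial>lborel)"
    using nn_integral_pdq_iter_weighted[OF f, of m] assms(2) n by auto
  have "(\<integral>\<^sup>+ x\<in>{0<..<1}. G (pdq_iter f n x) \<partial>lborel)
    = (\<integral>\<^sup>+ x. ennreal (f x ^ n / d) * G (f x / (c * ?k)) \<partial>lborel)"
    if [measurable]: "G \<in> borel_measurable borel" for G
  proof -
    have "(\<integral>\<^sup>+ x\<in>{0<..<1}. G (pdq_iter f n x) \<partial>lborel)
        = (\<integral>\<^sup>+ x. ennreal (?h x) * G (?h x / ?k) \<partial>lborel)"
      using nn_integral_pdq[OF h that] n by simp
    also have "\<dots> = (\<integral>\<^sup>+ x. ennreal (f x ^ Suc m / d) * G (f x / c / ?k) \<partial>lborel)"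
      by (rule *) measurable
    finally show ?thesis
      using n by simp
  qed
  then show ?thesis
    using c d k by (intro exI[of _ "c * ?k"] exI[of _ d]) auto
qed

section \<open>Moments of the iterates\<close>

text \<open>Take G y = y^k. The right side stays a nonnegative integral, since existence of iterate
  n alone does not make f^(n+k) integrable.\<close>

lemma pdq_iter_moment_scaled:
  assumes f: "prob_density f" and "pdq_exists f n" and "1 \<le> n"
  shows "\<exists>c>0. 0 < mu f n \<and> integrable lborel (\<lambda>x. f x ^ n) \<and>
    (\<forall>k. (\<integral>\<^sup>+ x\<in>{0<..<1}. ennreal (pdq_iter f n x ^ k) \<partial>lborel)
      = (\<integral>\<^sup>+ x. ennreal (f x ^ (n + k)) \<partial>lborel) * ennreal (1 / (mu f n * c ^ k)))"
proof -
  have [measurable]: "f \<in> borel_measurable borel" and f0: "\<And>x. 0 \<le> f x"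
    using f by (simp_all add: prob_density_def)
  obtain c d where c: "0 < c" and d: "0 < d" and *: "\<And>G. G \<in> borel_measurable borel \<Longrightarrow>
      (\<integral>\<^sup>+ x\<in>{0<..<1}. G (pdq_iter f n x) \<partial>lborel)
    = (\<integral>\<^sup>+ x. ennreal (f x ^ n / d) * G (f x / c) \<partial>lborel)"
    using nn_integral_pdq_iter[OF assms] by auto
  have moment: "(\<integral>\<^sup>+ x\<in>{0<..<1}. ennreal (pdq_iter f n x ^ k) \<partial>lborel)
      = (\<integral>\<^sup>+ x. ennreal (f x ^ (n + k)) \<partial>lborel) * ennreal (1 / (d * c ^ k))" for k
  proof -
    have "(\<integral>\<^sup>+ x\<in>{0<..<1}. ennreal (pdq_iter f n x ^ k) \<partial>lborel)
        = (\<integral>\<^sup>+ x. ennreal (f x ^ n / d) * ennreal ((f x / c) ^ k) \<partial>lborel)"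
      by (rule *) measurable
    also have "\<dots> = (\<integral>\<^sup>+ x. ennreal (f x ^ (n + k)) * ennreal (1 / (d * c ^ k)) \<partial>lborel)"
      using f0 c d
      by (intro nn_integral_cong)
        (simp add: ennreal_mult[symmetric] power_add power_divide)
    finally show ?thesis
      by (simp add: nn_integral_multc)
  qed
  have "(\<integral>\<^sup>+ x. ennreal (f x ^ n) \<partial>lborel)
      = (\<integral>\<^sup>+ x. ennreal (f x ^ n) \<partial>lborel) * ennreal (1 / d) * ennreal d"
    using d by (simp add: mult.assoc ennreal_mult[symmetric])
  also have "(\<integral>\<^sup>+ x. ennreal (f x ^ n) \<partial>lborel) * ennreal (1 / d) = 1"
    \<comment> \<open>For k = 0 the left side is the length of (0,1); this forces \<open>d\<close>
      to be the integral of f^n, which is therefore finite.\<close>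
    using moment[of 0] by simp
  finally have "(\<integral>\<^sup>+ x. ennreal (f x ^ n) \<partial>lborel) = ennreal d"
    by simp
  then have "integrable lborel (\<lambda>x. f x ^ n) \<and> mu f n = d"
    using f0 d unfolding mu_def by (subst (asm) nn_integral_eq_integrable) simp_all
  then show ?thesis
    using c d moment by auto
qed

lemma mu_pos:
  assumes "prob_density f" "infinite_star_order f" "1 \<le> n"
  shows "0 < mu f n"
  using pdq_iter_moment_scaled[of f n] assms by (auto simp: infinite_star_order_def)

lemma nn_integral_power_eq_mu:
  assumes "prob_density f" "infinite_star_order f" "1 \<le> n"
  shows "(\<integral>\<^sup>+ x. ennreal (f x ^ n) \<partial>lborel) = ennreal (mu f n)"
proof -
  have "integrable lborel (\<lambda>x. f x ^ n)"
    using pdq_iter_moment_scaled[of f n] assms by (auto simp: infinite_star_order_def)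
  then show ?thesis
    using assms(1) unfolding mu_def
    by (intro nn_integral_eq_integral) (auto simp: prob_density_def)
qed

lemma pdq_iter_moment:
  assumes f: "prob_density f" "infinite_star_order f" "1 \<le> n"
  shows "(\<integral>\<^sup>+ x\<in>{0<..<1}. ennreal (pdq_iter f n x ^ k) \<partial>lborel)
    = ennreal (mu f (n + k) / mu f n * (mu f n / mu f (n + 1)) ^ k)"
proof -
  have ex: "pdq_exists f n"
    using f by (simp add: infinite_star_order_def)
  have pos: "0 < mu f m" if "1 \<le> m" for m
    by (rule mu_pos[OF f(1,2) that])
  obtain c where c: "0 < c" and "\<forall>k. (\<integral>\<^sup>+ x\<in>{0<..<1}. ennreal (pdq_iter f n x ^ k) \<partial>lborel)
      = (\<integral>\<^sup>+ x. ennreal (f x ^ (n + k)) \<partial>lborel) * ennreal (1 / (mu f n * c ^ k))"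
    using pdq_iter_moment_scaled[OF f(1) ex f(3)] by blast
  then have m: "(\<integral>\<^sup>+ x\<in>{0<..<1}. ennreal (pdq_iter f n x ^ k) \<partial>lborel)
      = ennreal (mu f (n + k) / (mu f n * c ^ k))" for k
    using nn_integral_power_eq_mu[OF f(1,2), of "n + k"] f(3) pos[of "n + k"] pos[of n]
    by (simp add: ennreal_mult[symmetric])
  have "(\<integral>\<^sup>+ x\<in>{0<..<1}. ennreal (pdq_iter f n x ^ 1) \<partial>lborel)
      = (\<integral>\<^sup>+ x. ennreal (pdq_iter f n x) \<partial>lborel)"
    using f(3) by (cases n) (auto intro!: nn_integral_cong simp: pdq_def indicator_def)
  also have "\<dots> = 1"
    by (rule nn_integral_prob_density[OF prob_density_pdq_iter[OF f(1) ex]])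
  \<comment> \<open>As n >= 1, the iterate vanishes outside (0,1), so its mean under the uniform law
    is its total mass 1. This determines \<open>c\<close>.\<close>
  finally have "mu f (n + 1) / (mu f n * c) = 1"
    using m[of 1] pos[of "n + 1"] by simp
  then have "c = mu f (n + 1) / mu f n"
    using c pos[OF f(3)] by (simp add: field_simps)
  then show ?thesis
    unfolding m by (simp add: power_divide)
qed

section \<open>Moment bounds uniform in n\<close>

text \<open>The quantity bounded by B is the quotient of two consecutive ratios mu_{m+1} / mu_m, so
  each step multiplies the ratio by at most B.\<close>

lemma mu_ratio_bound:
  assumes f: "prob_density f" "infinite_star_order f" "1 \<le> n"
    and B: "\<And>n. 1 \<le> n \<Longrightarrow> mu f n * mu f (n + 2) / (mu f (n + 1))\<^sup>2 \<le> B"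
  shows "mu f (n + k + 1) / mu f (n + k) \<le> B ^ k * (mu f (n + 1) / mu f n)"
proof (induction k)
  case (Suc k)
  have pos: "0 < mu f m" if "1 \<le> m" for m
    by (rule mu_pos[OF f(1,2) that])
  let ?m = "n + k"
  have m: "1 \<le> ?m" using f(3) by simp
  have p: "0 < mu f ?m" "0 < mu f (?m + 1)" "0 < mu f (?m + 2)"
    by (rule pos, use m in simp)+
  then have "0 < mu f ?m * mu f (?m + 2) / (mu f (?m + 1))\<^sup>2"
    by simp
  \<comment> \<open>B dominates a positive number; the sign is what lets the two bounds be
    multiplied.\<close>
  then have "0 \<le> B"
    using B[OF m] by linarith
  have "mu f (?m + 2) / mu f (?m + 1)
      = mu f ?m * mu f (?m + 2) / (mu f (?m + 1))\<^sup>2 * (mu f (?m + 1) / mu f ?m)"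
    using p by (simp add: field_simps power2_eq_square)
  also have "\<dots> \<le> B * (B ^ k * (mu f (n + 1) / mu f n))"
    using B[OF m] Suc.IH p \<open>0 \<le> B\<close> by (intro mult_mono) auto
  finally show ?case
    by (simp add: mult.assoc)
qed simp

text \<open>The k-th moment telescopes into the product over j < k of the ratio at n + j divided by
  the ratio at n, and factor j is at most B^j. The bound does not depend on n.\<close>

lemma mu_moment_bound:
  assumes f: "prob_density f" "infinite_star_order f" "1 \<le> n"
    and B: "\<And>n. 1 \<le> n \<Longrightarrow> mu f n * mu f (n + 2) / (mu f (n + 1))\<^sup>2 \<le> B"
  shows "mu f (n + k) / mu f n * (mu f n / mu f (n + 1)) ^ k \<le> (\<Prod>j<k. B ^ j)"
proof (induction k)
  case 0
  show ?case using mu_pos[OF f] by simp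
next
  case (Suc k)
  have p: "0 < mu f n" "0 < mu f (n + 1)" "0 < mu f (n + k)" "0 < mu f (n + k + 1)"
    by (rule mu_pos[OF f(1,2)], use f(3) in simp)+
  have "mu f (n + Suc k) / mu f n * (mu f n / mu f (n + 1)) ^ Suc k
      = (mu f (n + k) / mu f n * (mu f n / mu f (n + 1)) ^ k)
        * (mu f (n + k + 1) / mu f (n + k) * (mu f n / mu f (n + 1)))"
    using p by (simp add: field_simps)
  also have "\<dots> \<le> (\<Prod>j<k. B ^ j) * B ^ k"
  proof (rule mult_mono[OF Suc.IH])
    show "mu f (n + k + 1) / mu f (n + k) * (mu f n / mu f (n + 1)) \<le> B ^ k"
      using mult_right_mono[OF mu_ratio_bound[OF f B, of k], of "mu f n / mu f (n + 1)"] p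
      by simp
    have "0 \<le> mu f (n + k) / mu f n * (mu f n / mu f (n + 1)) ^ k"
      using p by simp
    with Suc.IH show "0 \<le> (\<Prod>j<k. B ^ j)"
      by linarith
  qed (use p in simp)
  finally show ?case
    by simp
qed

section \<open>From convergence in probability to convergence in L_r\<close>

text \<open>The three summands cover deviations up to e, between e and K, and beyond K. In the last
  range the spare power, m >= r + 1, buys the factor 1 / K.\<close>

lemma powr_abs_diff_one_le:
  fixes y r e K :: real
  assumes "0 \<le> y" "0 < r" "0 < e" "1 \<le> K" "r + 1 \<le> real m"
  shows "\<bar>y - 1\<bar> powr r \<le> e powr r + K powr r * (if \<bar>y - 1\<bar> > e then 1 else 0) + (1 + y ^ m) / K"
proof -
  have y: "0 \<le> (1 + y ^ m) / K"
    using assms by simp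
  consider "\<bar>y - 1\<bar> \<le> e" | "e < \<bar>y - 1\<bar>" "\<bar>y - 1\<bar> \<le> K" | "e < \<bar>y - 1\<bar>" "K < \<bar>y - 1\<bar>"
    by linarith
  then show ?thesis
  proof cases
    case 1
    then have "\<bar>y - 1\<bar> powr r \<le> e powr r"
      using assms by (intro powr_mono2) auto
    with 1 y show ?thesis
      by simp
  next
    case 2
    then have "\<bar>y - 1\<bar> powr r \<le> K powr r"
      using assms by (intro powr_mono2) auto
    then have "\<bar>y - 1\<bar> powr r \<le> e powr r + K powr r + (1 + y ^ m) / K"
      by (intro add_increasing2[OF y] add_increasing[OF powr_ge_zero])
    with 2 show ?thesis
      by (simp only: if_True mult_1_right)
  next
    case 3
    \<comment> \<open>A deviation above K >= 1 cannot lie below 1 because y >= 0; hence y > 2 and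
      the deviation is y - 1.\<close>
    then have t: "1 < \<bar>y - 1\<bar>" "\<bar>y - 1\<bar> \<le> y"
      using assms by auto
    have "K * \<bar>y - 1\<bar> powr r \<le> \<bar>y - 1\<bar> * \<bar>y - 1\<bar> powr r"
      using 3 by (intro mult_right_mono) auto
    also have "\<dots> = \<bar>y - 1\<bar> powr (r + 1)"
      using t by (simp add: powr_add mult.commute)
    also have "\<dots> \<le> \<bar>y - 1\<bar> powr real m"
      using t assms by (intro powr_mono) auto
    also have "\<dots> = \<bar>y - 1\<bar> ^ m"
      using t by (subst powr_realpow) auto
    also have "\<dots> \<le> y ^ m"
      using t by (intro power_mono) auto
    finally have "\<bar>y - 1\<bar> powr r \<le> (1 + y ^ m) / K"
      using assms by (simp add: field_simps)
    then have "\<bar>y - 1\<bar> powr r \<le> e powr r + K powr r + (1 + y ^ m) / K"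
      by (intro add_increasing add_nonneg_nonneg powr_ge_zero)
    with 3 show ?thesis
      by (simp only: if_True mult_1_right)
  qed
qed

text \<open>Between 0 and any positive extended number lies a positive finite one.\<close>

lemma ennreal_tendsto_0I:
  fixes g :: "'a \<Rightarrow> ennreal"
  assumes "\<And>e::real. 0 < e \<Longrightarrow> eventually (\<lambda>n. g n \<le> ennreal e) F"
  shows "(g \<longlongrightarrow> 0) F"
proof (rule order_tendstoI)
  fix a :: ennreal assume "0 < a"
  then obtain b where b: "0 < b" "b < a"
    using dense by blast
  then have "b \<noteq> top"
    by auto
  then obtain e where e: "b = ennreal e" "0 \<le> e"
    by (cases b) auto
  with b have "0 < e"
    by simp
  from assms[OF this] show "\<forall>\<^sub>F n in F. g n < a"
    by eventually_elim (use b e in auto)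
qed simp

text \<open>A uniform integrability argument: the moment bound makes the tail beyond K small for all
  n at once, and convergence in probability handles the middle range. Each of the three summands
  gets e / 3.\<close>

lemma (in prob_space) Lr_tendsto_one_if_prob_tendsto_one:
  fixes Y :: "nat \<Rightarrow> 'a \<Rightarrow> real"
  assumes Y [measurable]: "\<And>n. 1 \<le> n \<Longrightarrow> Y n \<in> borel_measurable M"
    and nonneg: "\<And>n x. 1 \<le> n \<Longrightarrow> 0 \<le> Y n x"
    and C: "\<And>m. \<exists>C\<ge>0. \<forall>n\<ge>1. (\<integral>\<^sup>+ x. ennreal (Y n x ^ m) \<partial>M) \<le> ennreal C"
    and P: "\<And>e. 0 < e \<Longrightarrow> (\<lambda>n. prob {x \<in> space M. \<bar>Y n x - 1\<bar> > e}) \<longlonglongrightarrow> 0"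
    and r: "0 < r"
  shows "(\<lambda>n. \<integral>\<^sup>+ x. ennreal (\<bar>Y n x - 1\<bar> powr r) \<partial>M) \<longlonglongrightarrow> 0"
proof (rule ennreal_tendsto_0I)
  fix e :: real assume e: "0 < e"
  define m where "m = nat \<lceil>r\<rceil> + 1"
  have m: "r + 1 \<le> real m"
    unfolding m_def by linarith
  obtain C where C0: "0 \<le> C" and C: "\<And>n. 1 \<le> n \<Longrightarrow> (\<integral>\<^sup>+ x. ennreal (Y n x ^ m) \<partial>M) \<le> ennreal C"
    using C[of m] by auto
  define \<delta> where "\<delta> = (e / 3) powr (1 / r)"
  have \<delta>: "0 < \<delta>" "\<delta> powr r = e / 3"
    using e r by (simp_all add: \<delta>_def powr_powr)
  \<comment> \<open>Chosen so that the tail term is at most e / 3; the maximum with 1 secures the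
    assumption on K in \<open>powr_abs_diff_one_le\<close>.\<close>
  define K where "K = max 1 ((1 + C) / (e / 3))"
  have K: "1 \<le> K" "(1 + C) / K \<le> e / 3"
  proof -
    show K1: "1 \<le> K" by (simp add: K_def)
    have "(1 + C) / (e / 3) \<le> K" by (simp add: K_def)
    then show "(1 + C) / K \<le> e / 3"
      using e K1 by (simp add: field_simps)
  qed
  have split: "ennreal (a + b * p + c * z) = ennreal a + ennreal b * ennreal p + ennreal c * ennreal z"
    if "0 \<le> a" "0 \<le> b" "0 \<le> p" "0 \<le> c" "0 \<le> z" for a b p c z :: real
    using that by (simp add: ennreal_mult)
  let ?A = "\<lambda>n. {x \<in> space M. \<bar>Y n x - 1\<bar> > \<delta>}"
  \<comment> \<open>K depends on e and C but not on n, so this threshold is a fixed positive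
    number.\<close>
  have "eventually (\<lambda>n. prob (?A n) < (e / 3) / K powr r) sequentially"
    using order_tendstoD(2)[OF P[OF \<delta>(1)], of "(e / 3) / K powr r"] e K by simp
  then show "eventually (\<lambda>n. (\<integral>\<^sup>+ x. ennreal (\<bar>Y n x - 1\<bar> powr r) \<partial>M) \<le> ennreal e) sequentially"
    using eventually_ge_at_top[of 1]
  proof eventually_elim
    case (elim n)
    note [measurable] = Y[OF elim(2)]
    have "(\<integral>\<^sup>+ x. ennreal (\<bar>Y n x - 1\<bar> powr r) \<partial>M)
        \<le> (\<integral>\<^sup>+ x. ennreal (e / 3) + ennreal (K powr r) * indicator (?A n) x
            + ennreal (1 / K) * (1 + ennreal (Y n x ^ m)) \<partial>M)"
    proof (rule nn_integral_mono)
      fix x assume x: "x \<in> space M"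
      have "\<bar>Y n x - 1\<bar> powr r \<le> \<delta> powr r
          + K powr r * (if \<bar>Y n x - 1\<bar> > \<delta> then 1 else 0) + (1 + Y n x ^ m) / K"
        by (rule powr_abs_diff_one_le[OF nonneg[OF elim(2)] r \<delta>(1) K(1) m])
      then have "ennreal (\<bar>Y n x - 1\<bar> powr r) \<le> ennreal (e / 3
          + K powr r * (if \<bar>Y n x - 1\<bar> > \<delta> then 1 else 0) + (1 / K) * (1 + Y n x ^ m))"
        by (intro ennreal_leI) (simp add: \<delta>(2))
      also have "\<dots> = ennreal (e / 3)
            + ennreal (K powr r) * ennreal (if \<bar>Y n x - 1\<bar> > \<delta> then 1 else 0)
            + ennreal (1 / K) * ennreal (1 + Y n x ^ m)"
        using e K nonneg[OF elim(2), of x] by (intro split) auto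
      also have "\<dots> = ennreal (e / 3) + ennreal (K powr r) * indicator (?A n) x
            + ennreal (1 / K) * (1 + ennreal (Y n x ^ m))"
        using x nonneg[OF elim(2), of x] by (simp add: indicator_def)
      finally show "ennreal (\<bar>Y n x - 1\<bar> powr r) \<le> \<dots>" .
    qed
    also have "\<dots> = ennreal (e / 3) + ennreal (K powr r) * emeasure M (?A n)
        + ennreal (1 / K) * (1 + (\<integral>\<^sup>+ x. ennreal (Y n x ^ m) \<partial>M))"
      by (simp add: nn_integral_add nn_integral_cmult emeasure_space_1)
    also have "\<dots> \<le> ennreal (e / 3) + ennreal (K powr r) * ennreal (prob (?A n))
        + ennreal (1 / K) * (1 + ennreal C)"
      using C[OF elim(2)] by (intro add_mono mult_left_mono) (auto simp: emeasure_eq_measure)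
    also have "\<dots> = ennreal (e / 3 + K powr r * prob (?A n) + 1 / K * (1 + C))"
      using e K C0 split[of "e / 3" "K powr r" "prob (?A n)" "1 / K" "1 + C"] by simp
    also have "\<dots> \<le> ennreal e"
    proof (rule ennreal_leI)
      have 1: "K powr r * prob (?A n) \<le> e / 3"
        using elim(1) K by (simp add: field_simps)
      have 2: "1 / K * (1 + C) \<le> e / 3"
        using K(2) by simp
      have "e / 3 + K powr r * prob (?A n) + 1 / K * (1 + C) \<le> e / 3 + e / 3 + e / 3"
        by (intro add_mono order.refl 1 2)
      then show "e / 3 + K powr r * prob (?A n) + 1 / K * (1 + C) \<le> e"
        by (simp only: add_divide_distrib[symmetric]) simp
    qed
    finally show ?case .
  qed
qed

theorem theorem2p6:
  fixes f :: "real \<Rightarrow> real"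
  assumes "f \<in> density_class"
    and "infinite_star_order f"
    and "bounded ((\<lambda>n. mu f n * mu f (n + 2) / (mu f (n + 1))\<^sup>2) ` {1..})"
  defines "conv_in_prob \<equiv> \<forall>\<epsilon>>0.
      (\<lambda>n. measure lborel {x \<in> {0<..<1}. \<bar>pdq_iter f n x - 1\<bar> > \<epsilon>}) \<longlonglongrightarrow> 0"
    and "conv_in_Lr \<equiv> \<forall>r::real. r > 0 \<longrightarrow>
      (\<lambda>n. \<integral>\<^sup>+ x\<in>{0<..<1}. ennreal (\<bar>pdq_iter f n x - 1\<bar> powr r) \<partial>lborel) \<longlonglongrightarrow> 0"
    and "conv_ratio \<equiv> (\<lambda>n. mu f n * mu f (n + 2) / (mu f (n + 1))\<^sup>2) \<longlonglongrightarrow> 1"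
  shows "(conv_in_prob \<longleftrightarrow> conv_in_Lr) \<and> (conv_in_Lr \<longleftrightarrow> conv_ratio)"
proof -
  \<comment> \<open>The uniform law on (0,1), so that variance and Chebyshev's inequality become
    available for the iterates.\<close>
  let ?U = "restrict_space lborel {0<..<1} :: real measure"
  let ?Y = "pdq_iter f"
  let ?q = "\<lambda>n. mu f n * mu f (n + 2) / (mu f (n + 1))\<^sup>2"
  interpret U: prob_space ?U
    by (auto simp: emeasure_restrict_space space_restrict_space intro!: prob_spaceI)
  have f: "prob_density f"
    using assms(1) by (simp add: density_class_def prob_density_def)
  note f2 = f assms(2)
  have Y: "prob_density (?Y n)" if "1 \<le> n" for n
    using f2 that by (intro prob_density_pdq_iter) (auto simp: infinite_star_order_def)
  have meas: "?Y n \<in> borel_measurable ?U" if "1 \<le> n" for n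
    using Y[OF that] by (intro measurable_restrict_space1) (simp add: prob_density_def)
  have nonneg: "0 \<le> ?Y n x" if "1 \<le> n" for n x
    using Y[OF that] by (simp add: prob_density_def)
  have pos: "0 < mu f n" if "1 \<le> n" for n
    by (rule mu_pos[OF f2 that])
  have U_integral: "(\<integral>\<^sup>+ x. G x \<partial>?U) = (\<integral>\<^sup>+ x\<in>{0<..<1}. G x \<partial>lborel)" for G :: "real \<Rightarrow> ennreal"
    by (subst nn_integral_restrict_space) simp_all
  have U_prob: "U.prob {x \<in> space ?U. P x} = measure lborel {x \<in> {0<..<1}. P x}" for P
    by (subst measure_restrict_space) (auto simp: space_restrict_space)
  have moment: "(\<integral>\<^sup>+ x. ennreal (?Y n x ^ k) \<partial>?U)
      = ennreal (mu f (n + k) / mu f n * (mu f n / mu f (n + 1)) ^ k)" if "1 \<le> n" for n k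
    unfolding U_integral by (rule pdq_iter_moment[OF f2 that])
  have moment': "integrable ?U (\<lambda>x. ?Y n x ^ k)"
      "U.expectation (\<lambda>x. ?Y n x ^ k) = mu f (n + k) / mu f n * (mu f n / mu f (n + 1)) ^ k"
    if n: "1 \<le> n" for n k
  proof -
    have "0 \<le> mu f (n + k) / mu f n * (mu f n / mu f (n + 1)) ^ k"
      using pos[of n] pos[of "n + 1"] pos[of "n + k"] n by simp
    then show "integrable ?U (\<lambda>x. ?Y n x ^ k)"
      "U.expectation (\<lambda>x. ?Y n x ^ k) = mu f (n + k) / mu f n * (mu f n / mu f (n + 1)) ^ k"
      using moment[OF n, of k] meas[OF n] nonneg[OF n]
      by (subst (asm) nn_integral_eq_integrable, simp_all)+
  qed
  have mean: "U.expectation (?Y n) = 1" and second: "U.expectation (\<lambda>x. (?Y n x)\<^sup>2) = ?q n"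
    and int1: "integrable ?U (?Y n)" and int2: "integrable ?U (\<lambda>x. (?Y n x)\<^sup>2)"
    if n: "1 \<le> n" for n
    using moment'[OF n, of 1] moment'[OF n, of 2] pos[of n] pos[of "n + 1"] n
    by (simp_all add: power2_eq_square)
  have variance: "U.variance (?Y n) = ?q n - 1" if "1 \<le> n" for n
    using U.variance_eq[OF int1[OF that] int2[OF that]] mean[OF that] second[OF that] by simp
  have L2: "(\<integral>\<^sup>+ x. ennreal (\<bar>?Y n x - 1\<bar> powr 2) \<partial>?U) = ennreal (?q n - 1)" if n: "1 \<le> n" for n
  proof -
    have "integrable ?U (\<lambda>x. (?Y n x - 1)\<^sup>2)"
      using int1[OF n] int2[OF n] by (simp add: power2_diff)
    then have "(\<integral>\<^sup>+ x. ennreal ((?Y n x - 1)\<^sup>2) \<partial>?U) = ennreal (?q n - 1)"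
      using variance[OF n] mean[OF n] by (subst nn_integral_eq_integral) simp_all
    then show ?thesis by simp
  qed
  \<comment> \<open>A variance is nonnegative.\<close>
  have q_ge: "1 \<le> ?q n" if "1 \<le> n" for n
    using variance[OF that] U.variance_positive[of "?Y n"] by simp

  have "conv_in_Lr" if "conv_in_prob"
    unfolding conv_in_Lr_def
  proof (intro allI impI)
    fix r :: real assume r: "0 < r"
    obtain B where "\<forall>x\<in>?q ` {1..}. norm x \<le> B"
      using assms(3) unfolding bounded_iff by (elim exE)
    then have B: "?q n \<le> B" if "1 \<le> n" for n
      using that abs_le_D1[of "?q n" B] by simp
    show "(\<lambda>n. \<integral>\<^sup>+ x\<in>{0<..<1}. ennreal (\<bar>?Y n x - 1\<bar> powr r) \<partial>lborel) \<longlonglongrightarrow> 0"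
      unfolding U_integral[symmetric]
    proof (rule U.Lr_tendsto_one_if_prob_tendsto_one[OF meas nonneg _ _ r])
      show "\<exists>C\<ge>0. \<forall>n\<ge>1. (\<integral>\<^sup>+ x. ennreal (?Y n x ^ m) \<partial>?U) \<le> ennreal C" for m
      proof (intro exI[of _ "\<Prod>j<m. B ^ j"] conjI allI impI)
        show "0 \<le> (\<Prod>j<m. B ^ j)"
          \<comment> \<open>B is at least ?q 1, which is at least 1.\<close>
          using B[of 1] q_ge[of 1] by (intro prod_nonneg) auto
        fix n :: nat assume n: "1 \<le> n"
        show "(\<integral>\<^sup>+ x. ennreal (?Y n x ^ m) \<partial>?U) \<le> ennreal (\<Prod>j<m. B ^ j)"
          unfolding moment[OF n] by (intro ennreal_leI mu_moment_bound[OF f2 n B])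
      qed
      show "(\<lambda>n. U.prob {x \<in> space ?U. \<bar>?Y n x - 1\<bar> > e}) \<longlonglongrightarrow> 0" if "0 < e" for e
        using \<open>conv_in_prob\<close> that unfolding conv_in_prob_def U_prob by blast
    qed
  qed
  \<comment> \<open>The case r = 2 suffices, since that integral is exactly ?q n - 1 for n >=
    1.\<close>
  moreover have "conv_ratio" if "conv_in_Lr"
  proof -
    have "(\<lambda>n. \<integral>\<^sup>+ x. ennreal (\<bar>?Y n x - 1\<bar> powr 2) \<partial>?U) \<longlonglongrightarrow> 0"
      unfolding U_integral by (rule that[unfolded conv_in_Lr_def, rule_format]) simp
    moreover have "\<forall>\<^sub>F n in sequentially.
        (\<integral>\<^sup>+ x. ennreal (\<bar>?Y n x - 1\<bar> powr 2) \<partial>?U) = ennreal (?q n - 1)"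
      using eventually_ge_at_top[of 1] by eventually_elim (rule L2)
    ultimately have "(\<lambda>n. ennreal (?q n - 1)) \<longlonglongrightarrow> ennreal 0"
      unfolding ennreal_0 by (rule Lim_transform_eventually)
    \<comment> \<open>\<open>ennreal\<close> truncates negative reals to 0, so the limit transfers
      back to the reals only with the sign of ?q n - 1 known.\<close>
    moreover have "\<forall>\<^sub>F n in sequentially. 0 \<le> ?q n - 1"
      using eventually_ge_at_top[of 1] by eventually_elim (use q_ge in fastforce)
    ultimately have "(\<lambda>n. ?q n - 1) \<longlonglongrightarrow> 0"
      by (rule iffD1[OF tendsto_ennreal_iff, rotated 2]) simp
    then show ?thesis
      unfolding conv_ratio_def by (rule LIM_zero_cancel)
  qed
  moreover have "conv_in_prob" if "conv_ratio"
    unfolding conv_in_prob_def U_prob[symmetric]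
  proof (intro allI impI)
    fix e :: real assume e: "0 < e"
    have "(\<lambda>n. (?q n - 1) / e\<^sup>2) \<longlonglongrightarrow> 0"
      using tendsto_divide[OF LIM_zero[OF that[unfolded conv_ratio_def]] tendsto_const[of "e\<^sup>2"]] e
      by simp
    then show "(\<lambda>n. U.prob {x \<in> space ?U. \<bar>?Y n x - 1\<bar> > e}) \<longlonglongrightarrow> 0"
    proof (rule tendsto_sandwich[OF _ _ tendsto_const, rotated 2])
      show "\<forall>\<^sub>F n in sequentially. U.prob {x \<in> space ?U. \<bar>?Y n x - 1\<bar> > e} \<le> (?q n - 1) / e\<^sup>2"
        using eventually_ge_at_top[of 1]
      proof eventually_elim
        case (elim n)
        note [measurable] = meas[OF elim]
        \<comment> \<open>Chebyshev's inequality is about deviations >= e from the mean, which is 1;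
          the strict event is contained in that one.\<close>
        have "U.prob {x \<in> space ?U. \<bar>?Y n x - 1\<bar> > e}
            \<le> U.prob {x \<in> space ?U. e \<le> \<bar>?Y n x - U.expectation (?Y n)\<bar>}"
          unfolding mean[OF elim] by (intro U.finite_measure_mono) (force, measurable)
        also have "\<dots> \<le> U.variance (?Y n) / e\<^sup>2"
          by (rule U.Chebyshev_inequality[OF meas[OF elim] int2[OF elim] e])
        finally show ?case
          by (simp only: variance[OF elim])
      qed
    qed simp_all
  qed
  ultimately show ?thesis
    by blast
qed

end
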